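(* Let $p,q$ be integers with $p\geq q\geq 3$, and write $p-1=t(q-1)+r$ with $t=\left\lfloor \frac{p-1}{q-1}\right\rfloor$ and $0\leq r<q-1$ (so $r$ is the remainder of $p-1$ upon division by $q-1$). Let $n\geq 2p^2$ and let $G$ be a (simple) graph with $n$ vertices satisfying the $(p,q)$-property. Then \[ |E(G)|\leq \binom{n}{2}-\binom{n-t}{2}+r . \] Moreover, this bound is sharp: for such $n,p,q$ there exists a graph on $n$ vertices with the $(p,q)$-property and exactly $\binom{n}{2}-\binom{n-t}{2}+r$ edges.
   Context: A hypergraph (in particular a graph) satisfies the $(p,q)$-property if among any $p$ of its edges some $q$ of them have a common vertex (a graph with fewer than $p$ edges satisfies it vacuously). *)

theory Defs
  imports Complex_Main
begin

definition simple_graph :: "'a set \<Rightarrow> 'a set set \<Rightarrow> bool" where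
  "simple_graph V E \<longleftrightarrow> finite V \<and> (\<forall>e\<in>E. e \<subseteq> V \<and> card e = 2)"

(* Stated for an arbitrary hypergraph with vertex set V and edge set E.
   Since card is 0 on infinite sets, F and F' are finite whenever p and q are positive. *)
definition pq_property :: "nat \<Rightarrow> nat \<Rightarrow> 'a set \<Rightarrow> 'a set set \<Rightarrow> bool" where
  "pq_property p q V E \<longleftrightarrow>
     (\<forall>F. F \<subseteq> E \<and> card F = p \<longrightarrow>
        (\<exists>F'. F' \<subseteq> F \<and> card F' = q \<and> (\<exists>v\<in>V. \<forall>e\<in>F'. v \<in> e)))"

end

theory Submission
  imports Defs
begin

text \<open>
  Put \<open>D = q - 1\<close>, so that \<open>p - 1 = t * D + r\<close>: the \<open>(p, q)\<close>-property says that no \<open>p\<close> edges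
  form a subgraph of maximum degree at most \<open>D\<close>. Call a vertex high if its degree is at least
  \<open>2 * p - 1\<close>. If there is a set \<open>T\<close> of \<open>t\<close> high vertices, then at most \<open>r\<close> edges avoid \<open>T\<close>: any
  \<open>r + 1 \<le> D\<close> such edges could be completed greedily by \<open>t\<close> stars with \<open>D\<close> edges each, centred
  at \<open>T\<close> and with fresh leaves, to \<open>p\<close> edges of maximum degree at most \<open>D\<close>. Otherwise delete the
  fewer than \<open>t\<close> high vertices and take a maximal subgraph \<open>F\<close> of maximum degree at most \<open>D\<close> in
  the rest. It has at most \<open>p - 1\<close> edges, hence, as \<open>D \<ge> 2\<close>, at most \<open>p - 1\<close> vertices of
  \<open>F\<close>-degree \<open>D\<close>; every remaining edge meets one of these or lies in \<open>F\<close>, so at most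
  \<open>(p - 1) * (2 * p - 1) \<le> n - t\<close> edges remain, no more than one further full vertex would give.
\<close>

section \<open>Degrees in an edge set, and bounded degree as the obstruction to the
  \<open>(p, q)\<close>-property\<close>

definition deg :: "'a set set \<Rightarrow> 'a \<Rightarrow> nat" where
  "deg F v = card {e \<in> F. v \<in> e}"

lemma simple_graph_finite_edges:
  assumes "simple_graph V E" shows "finite E"
proof -
  have "E \<subseteq> Pow V" "finite V" using assms by (auto simp: simple_graph_def)
  then show ?thesis by (meson finite_Pow_iff finite_subset)
qed

lemma deg_le_card: "finite F \<Longrightarrow> deg F v \<le> card F"
  unfolding deg_def by (rule card_mono) auto

lemma deg_Un: "finite A \<Longrightarrow> finite B \<Longrightarrow> deg (A \<union> B) v \<le> deg A v + deg B v"
  unfolding deg_def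
  by (rule order_trans[OF _ card_Un_le]) (auto intro!: card_mono)

text \<open>This is the form in which the property is used: \<open>q\<close> edges of
  \<open>F\<close> with a common vertex would give it degree at least \<open>q\<close>. The premise
  \<open>p > 0\<close> makes \<open>F\<close> finite, as infinite sets have cardinality 0.\<close>

lemma pq_property_no_bounded_deg:
  assumes "pq_property p q V E" "F \<subseteq> E" "card F = p" "p > 0"
    and "\<And>v. deg F v < q"
  shows False
proof -
  obtain F' v where F': "F' \<subseteq> F" "card F' = q" "\<forall>e\<in>F'. v \<in> e"
    using assms(1-3) unfolding pq_property_def by blast
  have "finite F" using assms(3,4) card_ge_0_finite by metis
  then have "card F' \<le> deg F v"
    unfolding deg_def using F' by (intro card_mono) auto
  then show False using F'(2) assms(5)[of v] by simp
qed

section \<open>Counting the edges that meet a vertex set\<close>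

text \<open>The set difference consists of the pairs that meet \<open>T\<close>: the edges present
  when every vertex of \<open>T\<close> is full, that is, joined to all others.\<close>

lemma card_pairs_meeting:
  assumes "finite V" "T \<subseteq> V"
  shows "card ({e. e \<subseteq> V \<and> card e = 2} - {e. e \<subseteq> V - T \<and> card e = 2})
           = (card V choose 2) - ((card V - card T) choose 2)"
proof -
  let ?A = "{e. e \<subseteq> V \<and> card e = 2}" and ?B = "{e. e \<subseteq> V - T \<and> card e = 2}"
  have fin: "finite ?A" "finite ?B" using assms(1) by auto
  have "card (?A - ?B) = card ?A - card ?B"
    by (rule card_Diff_subset) (use fin in auto)
  then show ?thesis
    using n_subsets[of V 2] n_subsets[of "V - T" 2] assms
    by (simp add: card_Diff_subset finite_subset)
qed

lemma card_edges_le_card_edges_off: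
  assumes "simple_graph V E" "T \<subseteq> V"
  shows "card E \<le> (card V choose 2) - ((card V - card T) choose 2) + card {e \<in> E. e \<inter> T = {}}"
proof -
  have fV: "finite V" and E: "\<And>e. e \<in> E \<Longrightarrow> e \<subseteq> V \<and> card e = 2"
    using assms(1) by (auto simp: simple_graph_def)
  let ?A = "{e. e \<subseteq> V \<and> card e = 2}" and ?B = "{e. e \<subseteq> V - T \<and> card e = 2}"
  have fin: "finite ?A" using fV by auto
  have 1: "card (?A - ?B) = (card V choose 2) - ((card V - card T) choose 2)"
    using fV assms(2) by (rule card_pairs_meeting)
  have "E \<subseteq> (?A - ?B) \<union> {e \<in> E. e \<inter> T = {}}" using E by fastforce
  then have "card E \<le> card ((?A - ?B) \<union> {e \<in> E. e \<inter> T = {}})"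
    using fin simple_graph_finite_edges[OF assms(1)] by (intro card_mono) auto
  also have "\<dots> \<le> card (?A - ?B) + card {e \<in> E. e \<inter> T = {}}" by (rule card_Un_le)
  finally show ?thesis using 1 by simp
qed

section \<open>Greedy stars at vertices of high degree\<close>

text \<open>Each vertex of the forbidden set \<open>B\<close> rules out at most one neighbour of
  \<open>x\<close>, so at least \<open>D\<close> neighbours remain as possible leaves.\<close>

lemma star_exists:
  assumes sg: "simple_graph V E" and B: "finite B" "x \<notin> B" and d: "deg E x \<ge> card B + D"
  obtains L where "finite L" "card L = D" "x \<notin> L" "L \<inter> B = {}" "(\<lambda>y. {x, y}) ` L \<subseteq> E"
proof -
  let ?N = "{y. {x, y} \<in> E}"
  have E: "\<And>e. e \<in> E \<Longrightarrow> e \<subseteq> V \<and> card e = 2" and fV: "finite V"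
    using sg by (auto simp: simple_graph_def)
  have "?N \<subseteq> V" using E by blast
  then have fN: "finite ?N" using fV finite_subset by blast
  have "{e \<in> E. x \<in> e} \<subseteq> (\<lambda>y. {x, y}) ` ?N"
  proof
    fix e assume "e \<in> {e \<in> E. x \<in> e}"
    then have "e \<in> E" "x \<in> e" "card e = 2" using E by auto
    then obtain y where "e = {x, y}" by (auto simp: card_2_iff)
    then show "e \<in> (\<lambda>y. {x, y}) ` ?N" using \<open>e \<in> E\<close> by auto
  qed
  then have "deg E x \<le> card ?N"
    unfolding deg_def using fN surj_card_le by blast
  moreover have "card ?N - card B \<le> card (?N - B)"
    using B(1) by (rule diff_card_le_card_Diff)
  ultimately have "D \<le> card (?N - B)" using d by simp
  then obtain L where L: "L \<subseteq> ?N - B" "card L = D" "finite L"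
    by (rule obtain_subset_with_card_n)
  \<comment> \<open>A leaf equal to the centre would make the singleton \<open>{x}\<close> an
    edge.\<close>
  have "x \<notin> ?N" using E[of "{x}"] by auto
  then show ?thesis using that[of L] L by blast
qed

lemma deg_star_le_1: "deg ((\<lambda>y. {x, y}) ` L) v \<le> 1" if "v \<noteq> x"
proof -
  have "{e \<in> (\<lambda>y. {x, y}) ` L. v \<in> e} \<subseteq> {{x, v}}" using that by auto
  then have "card {e \<in> (\<lambda>y. {x, y}) ` L. v \<in> e} \<le> card {{x, v}}"
    by (intro card_mono) auto
  then show ?thesis by (simp add: deg_def)
qed

lemma deg_eq_0: "deg F v = 0" if "v \<notin> \<Union>F"
proof -
  have "{e \<in> F. v \<in> e} = {}" using that by auto
  then show ?thesis by (simp only: deg_def card.empty)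
qed

text \<open>
  The bound on \<open>card (\<Union>F - T)\<close> is the induction invariant: only one end of each star edge is a
  new vertex, so counting all ends of \<open>F\<close> would be too wasteful.
\<close>

lemma extend_by_stars:
  assumes sg: "simple_graph V E" and T: "finite T" and D: "D \<ge> 1"
    and F0: "F0 \<subseteq> E" "\<And>e. e \<in> F0 \<Longrightarrow> e \<inter> T = {}" "\<And>v. deg F0 v \<le> D"
    and high: "\<And>v. v \<in> T \<Longrightarrow> deg E v \<ge> card T - 1 + 2 * card F0 + card T * D"
    and "U \<subseteq> T"
  shows "\<exists>F \<subseteq> E. card F = card F0 + card U * D \<and> (\<forall>v. deg F v \<le> D)
           \<and> (\<forall>e\<in>F. e \<inter> (T - U) = {}) \<and> card (\<Union>F - T) \<le> 2 * card F0 + card U * D"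
proof -
  have fE: "finite E" using sg by (rule simple_graph_finite_edges)
  have E: "\<And>e. e \<in> E \<Longrightarrow> e \<subseteq> V \<and> card e = 2" and fV: "finite V"
    using sg by (auto simp: simple_graph_def)
  have "finite U" using T \<open>U \<subseteq> T\<close> finite_subset by blast
  then show ?thesis using \<open>U \<subseteq> T\<close>
  proof (induction U rule: finite_induct)
    case empty
    have "finite F0" using F0(1) fE finite_subset by blast
    then have "card (\<Union>F0) \<le> (\<Sum>e\<in>F0. card e)"
      using card_Union_le_sum_card by blast
    also have "\<dots> = (\<Sum>e\<in>F0. 2)" using E F0(1) by (intro sum.cong) auto
    finally have "card (\<Union>F0) \<le> 2 * card F0" by simp
    moreover have "card (\<Union>F0 - T) \<le> card (\<Union>F0)"
      using F0(1) E fV by (intro card_mono finite_subset[of "\<Union>F0" V]) auto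
    ultimately show ?case using F0 by (intro exI[of _ F0]) auto
  next
    case (insert x U)
    then obtain F where F: "F \<subseteq> E" "card F = card F0 + card U * D" "\<And>v. deg F v \<le> D"
      "\<And>e. e \<in> F \<Longrightarrow> e \<inter> (T - U) = {}" "card (\<Union>F - T) \<le> 2 * card F0 + card U * D"
      by auto
    have fF: "finite F" using F(1) fE finite_subset by blast
    have fUF: "finite (\<Union>F)" using F(1) E fV by (intro finite_subset[of "\<Union>F" V]) auto
    have x: "x \<in> T" "x \<notin> U" using insert by auto
    then have xF: "x \<notin> \<Union>F" using F(4) by blast
    \<comment> \<open>Forbidden leaves: the other centres, whose degrees must not grow, and the
      vertices outside \<open>T\<close> that \<open>F\<close> already uses.\<close>
    let ?B = "(T - {x}) \<union> (\<Union>F - T)"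
    have "card ?B \<le> card (T - {x}) + card (\<Union>F - T)" by (rule card_Un_le)
    also have "\<dots> \<le> card T - 1 + (2 * card F0 + card U * D)" using x F(5) T by simp
    finally have cB: "card ?B \<le> card T - 1 + (2 * card F0 + card U * D)" .
    have "card (insert x U) \<le> card T" using insert.prems T by (intro card_mono) auto
    then have cU: "Suc (card U) \<le> card T" using insert.hyps by simp
    have "card ?B + D \<le> card T - 1 + 2 * card F0 + Suc (card U) * D" using cB by simp
    also have "\<dots> \<le> card T - 1 + 2 * card F0 + card T * D"
      using cU by (intro add_left_mono mult_le_mono1)
    also have "\<dots> \<le> deg E x" using high x by blast
    finally have "deg E x \<ge> card ?B + D" .
    moreover have "finite ?B" "x \<notin> ?B" using T fUF x by auto
    ultimately obtain L where L: "finite L" "card L = D" "x \<notin> L" "L \<inter> ?B = {}"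
      "(\<lambda>y. {x, y}) ` L \<subseteq> E"
      using star_exists[OF sg] by metis
    let ?S = "(\<lambda>y. {x, y}) ` L"
    have "inj_on (\<lambda>y. {x, y}) L" by (auto simp: inj_on_def doubleton_eq_iff)
    then have cS: "card ?S = D" using L(2) by (simp add: card_image)
    have LT: "L \<inter> T = {}" "L \<inter> \<Union>F = {}" using L x by auto
    have "F \<inter> ?S = {}" using xF by auto
    then have "card (F \<union> ?S) = card F + D" using cS fF L(1) by (simp add: card_Un_disjoint)
    then have 1: "card (F \<union> ?S) = card F0 + card (insert x U) * D"
      using F(2) insert.hyps by simp
    have 2: "deg (F \<union> ?S) v \<le> D" for v
    proof -
      have le: "deg (F \<union> ?S) v \<le> deg F v + deg ?S v" using fF L(1) by (intro deg_Un) auto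
      consider "v = x" | "v \<in> \<Union>F" "v \<noteq> x" | "v \<notin> \<Union>F" "v \<noteq> x" by blast
      then show ?thesis
      proof cases
        case 1
        have "deg ?S x \<le> D" using deg_le_card[of ?S x] L(1) cS by simp
        then show ?thesis using le deg_eq_0[OF xF] 1 by simp
      next
        case 2
        then have "v \<notin> \<Union>?S" using LT by auto
        then have "deg ?S v = 0" by (rule deg_eq_0)
        then show ?thesis using le F(3)[of v] by linarith
      next
        case 3
        then show ?thesis using le deg_eq_0[of v F] deg_star_le_1[of v x L] D by simp
      qed
    qed
    have 3: "\<forall>e\<in>F \<union> ?S. e \<inter> (T - insert x U) = {}" using F(4) LT by auto
    \<comment> \<open>The centre lies in \<open>T\<close>, so the new star adds only its
      \<open>D\<close> leaves to the invariant.\<close>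
    have "\<Union>(F \<union> ?S) - T \<subseteq> (\<Union>F - T) \<union> L" using x by auto
    then have "card (\<Union>(F \<union> ?S) - T) \<le> card ((\<Union>F - T) \<union> L)"
      using fUF L(1) by (intro card_mono) auto
    also have "\<dots> \<le> card (\<Union>F - T) + card L" by (rule card_Un_le)
    finally have 4: "card (\<Union>(F \<union> ?S) - T) \<le> 2 * card F0 + card (insert x U) * D"
      using F(5) L(2) insert.hyps by simp
    show ?case using 1 2 3 4 F(1) L(5) by (intro exI[of _ "F \<union> ?S"]) auto
  qed
qed

text \<open>Taking exactly \<open>r + 1\<close> edges off \<open>T\<close> makes the completed edge
  set have \<open>r + 1 + t * D = p\<close> edges.\<close>

lemma card_edges_off_high_vertices:
  assumes sg: "simple_graph V E" and pq: "pq_property p (Suc D) V E"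
    and T: "finite T" "card T = t" and p: "p = Suc (t * D + r)" and r: "r < D"
    and high: "\<And>v. v \<in> T \<Longrightarrow> deg E v \<ge> 2 * p - 1"
  shows "card {e \<in> E. e \<inter> T = {}} \<le> r"
proof (rule ccontr)
  assume "\<not> ?thesis"
  then have "Suc r \<le> card {e \<in> E. e \<inter> T = {}}" by simp
  then obtain F0 where F0: "F0 \<subseteq> {e \<in> E. e \<inter> T = {}}" "card F0 = Suc r" "finite F0"
    by (rule obtain_subset_with_card_n)
  have "deg F0 v \<le> D" for v using deg_le_card[OF F0(3), of v] F0(2) r by simp
  \<comment> \<open>The threshold \<open>2 * p - 1\<close> comes from here: the greedy step needs
    degree \<open>t - 1 + 2 * (r + 1) + t * D\<close>, which is at most
    \<open>2 * t * D + 2 * r + 1\<close> because \<open>t \<le> t * D\<close>.\<close>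
  moreover have "card T - 1 + 2 * card F0 + card T * D \<le> deg E v" if "v \<in> T" for v
  proof -
    have "t \<ge> 1" using that T by (metis One_nat_def Suc_leI card_gt_0_iff empty_iff)
    moreover have "t \<le> t * D" using r by simp
    ultimately have "card T - 1 + 2 * card F0 + card T * D \<le> 2 * p - 1"
      using F0(2) T(2) p by simp
    then show ?thesis using high[OF that] by simp
  qed
  moreover have "F0 \<subseteq> E" "\<And>e. e \<in> F0 \<Longrightarrow> e \<inter> T = {}" "D \<ge> 1" using F0(1) r by auto
  ultimately obtain F where "F \<subseteq> E" "card F = card F0 + card T * D" "\<And>v. deg F v \<le> D"
    using extend_by_stars[OF sg T(1), of D F0 T] by blast
  then show False
    using pq_property_no_bounded_deg[OF pq, of F] F0(2) T(2) p by (simp add: less_Suc_eq_le)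
qed

section \<open>Counting edges when all degrees are low\<close>

lemma handshake:
  assumes "simple_graph V F" shows "(\<Sum>v\<in>V. deg F v) = 2 * card F"
proof -
  have fV: "finite V" and F: "\<And>e. e \<in> F \<Longrightarrow> e \<subseteq> V \<and> card e = 2"
    using assms by (auto simp: simple_graph_def)
  have fF: "finite F" using assms by (rule simple_graph_finite_edges)
  show ?thesis
    unfolding deg_def
  proof (rule sum_multicount[OF fV fF])
    show "\<forall>e\<in>F. card {v \<in> V. v \<in> e} = 2"
    proof
      fix e assume "e \<in> F"
      then have "{v \<in> V. v \<in> e} = e" "card e = 2" using F by blast+
      then show "card {v \<in> V. v \<in> e} = 2" by simp
    qed
  qed
qed

text \<open>For a maximal \<open>F\<close> of degree at most \<open>D\<close>, every edge outside
  \<open>F\<close> has a saturated end, of \<open>F\<close>-degree \<open>D\<close>. At most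
  \<open>M\<close> vertices are saturated, each on at most \<open>\<Delta>\<close> edges, which
  gives \<open>M + M * \<Delta>\<close>.\<close>

lemma card_edges_le_of_low_degrees:
  assumes sg: "simple_graph V H" and D: "D \<ge> 2"
    and low: "\<And>v. v \<in> V \<Longrightarrow> deg H v \<le> \<Delta>"
    and small: "\<And>F. F \<subseteq> H \<Longrightarrow> (\<And>v. deg F v \<le> D) \<Longrightarrow> card F \<le> M"
  shows "card H \<le> M * Suc \<Delta>"
proof -
  have fV: "finite V" and H: "\<And>e. e \<in> H \<Longrightarrow> e \<subseteq> V \<and> card e = 2"
    using sg by (auto simp: simple_graph_def)
  have fH: "finite H" using sg by (rule simple_graph_finite_edges)
  let ?P = "{F. F \<subseteq> H \<and> (\<forall>v. deg F v \<le> D)}"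
  have "finite ?P" using fH by simp
  moreover have "{} \<in> ?P" by (simp add: deg_def)
  ultimately have "\<exists>F\<in>?P. \<forall>F'\<in>?P. F \<subseteq> F' \<longrightarrow> F = F'"
    by (intro finite_has_maximal) (simp, metis empty_iff)
  then obtain F where FP: "F \<in> ?P" and mx: "\<forall>F'\<in>?P. F \<subseteq> F' \<longrightarrow> F = F'" ..
  then have F: "F \<subseteq> H" "\<And>v. deg F v \<le> D" by auto
  have fF: "finite F" using F(1) fH by (rule finite_subset)
  have cF: "card F \<le> M" using F by (rule small)
  let ?Sat = "{v \<in> V. deg F v = D}"
  \<comment> \<open>Saturated vertices take \<open>D * card ?Sat\<close> of the
    \<open>2 * card F\<close> edge ends, so \<open>D \<ge> 2\<close> allows at most
    \<open>card F\<close> of them.\<close>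
  have "D * card ?Sat = (\<Sum>v\<in>?Sat. deg F v)" by simp
  also have "\<dots> \<le> (\<Sum>v\<in>V. deg F v)" using fV by (intro sum_mono2) auto
  also have "\<dots> = 2 * card F"
    using F(1) sg unfolding simple_graph_def by (intro handshake) (auto simp: simple_graph_def)
  finally have "2 * card ?Sat \<le> 2 * M" using cF D mult_le_mono1[OF D, of "card ?Sat"] by linarith
  then have cSat: "card ?Sat \<le> M" by simp
  \<comment> \<open>An edge outside \<open>F\<close> without a saturated end could be added to
    \<open>F\<close>, against maximality.\<close>
  have "H \<subseteq> F \<union> (\<Union>v\<in>?Sat. {e \<in> H. v \<in> e})"
  proof
    fix e assume e: "e \<in> H"
    show "e \<in> F \<union> (\<Union>v\<in>?Sat. {e \<in> H. v \<in> e})"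
    proof (rule ccontr)
      assume n: "\<not> ?thesis"
      have "deg (insert e F) v \<le> D" for v
      proof (cases "v \<in> e")
        case True
        then have "v \<in> V" using H e by blast
        then have "deg F v \<noteq> D" using n True e by blast
        then have "deg F v < D" using F(2)[of v] by simp
        moreover have "deg (insert e F) v \<le> Suc (deg F v)"
          using deg_Un[of "{e}" F v] deg_le_card[of "{e}" v] fF by simp
        ultimately show ?thesis by simp
      next
        case False
        then have "{e' \<in> insert e F. v \<in> e'} = {e' \<in> F. v \<in> e'}" by auto
        then show ?thesis using F(2)[of v] by (simp only: deg_def)
      qed
      then have "insert e F \<in> ?P" using F(1) e by simp
      then have "F = insert e F" using bspec[OF mx] subset_insertI[of F e] by simp
      then show False using n by blast
    qed
  qed
  then have "card H \<le> card (F \<union> (\<Union>v\<in>?Sat. {e \<in> H. v \<in> e}))"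
    using fF fV fH by (intro card_mono) auto
  also have "\<dots> \<le> card F + card (\<Union>v\<in>?Sat. {e \<in> H. v \<in> e})" by (rule card_Un_le)
  also have "\<dots> \<le> card F + (\<Sum>v\<in>?Sat. deg H v)"
    unfolding deg_def using fV by (intro add_left_mono card_UN_le) auto
  also have "\<dots> \<le> M + card ?Sat * \<Delta>"
    using cF low sum_bounded_above[of ?Sat "deg H" \<Delta>] by (intro add_mono) auto
  also have "\<dots> \<le> M + M * \<Delta>" using cSat by simp
  finally show ?thesis by simp
qed

text \<open>Making a \<open>t\<close>-th vertex full after \<open>t - 1\<close> others adds
  \<open>n - t\<close> new pairs, and \<open>s\<close> is at most \<open>t - 1\<close>.\<close>

lemma choose_two_diff_mono:
  assumes "s < t" "t \<le> n"
  shows "(n choose 2) - ((n - s) choose 2) + (n - t) \<le> (n choose 2) - ((n - t) choose 2)"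
proof -
  have "((n - t) choose 2) + (n - t) = Suc (n - t) choose 2" by (simp add: numeral_2_eq_2)
  also have "\<dots> \<le> (n - s) choose 2" using assms by (intro binomial_right_mono) auto
  finally have "((n - t) choose 2) + (n - t) \<le> (n - s) choose 2" .
  moreover have "(n - s) choose 2 \<le> n choose 2" by (intro binomial_right_mono) auto
  ultimately show ?thesis by simp
qed

section \<open>The upper bound, by the number of high vertices\<close>

lemma card_edges_upper_bound:
  assumes sg: "simple_graph V E" and n: "card V = n" and pq: "pq_property p (Suc D) V E"
    and p: "p = Suc (t * D + r)" and r: "r < D" and D: "D \<ge> 2" and big: "n \<ge> 2 * p ^ 2"
  shows "card E \<le> (n choose 2) - ((n - t) choose 2) + r"
proof -
  let ?S = "{v \<in> V. deg E v \<ge> 2 * p - 1}"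
  show ?thesis
  proof (cases "t \<le> card ?S")
    case True
    then obtain T where T: "T \<subseteq> ?S" "card T = t" "finite T"
      by (rule obtain_subset_with_card_n)
    have "card {e \<in> E. e \<inter> T = {}} \<le> r"
      by (rule card_edges_off_high_vertices[OF sg pq T(3,2) p r]) (use T(1) in auto)
    moreover have "T \<subseteq> V" using T(1) by auto
    ultimately show ?thesis
      using card_edges_le_card_edges_off[OF sg, of T] T(2) n by simp
  next
    case False
    let ?H = "{e \<in> E. e \<inter> ?S = {}}"
    have fE: "finite E" using sg by (rule simple_graph_finite_edges)
    have "card ?H \<le> (p - 1) * Suc (2 * p - 2)"
    proof (rule card_edges_le_of_low_degrees[OF _ D])
      show "simple_graph V ?H" using sg by (auto simp: simple_graph_def)
    next
      fix v assume v: "v \<in> V"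
      show "deg ?H v \<le> 2 * p - 2"
      proof (cases "v \<in> ?S")
        case True
        then have "v \<notin> \<Union>?H" by blast
        then have "deg ?H v = 0" by (rule deg_eq_0)
        then show ?thesis by simp
      next
        case False
        have "deg ?H v \<le> deg E v" unfolding deg_def using fE by (intro card_mono) auto
        then show ?thesis using False v by simp
      qed
    next
      fix F assume F: "F \<subseteq> ?H" "\<And>v. deg F v \<le> D"
      show "card F \<le> p - 1"
      proof (rule ccontr)
        assume "\<not> card F \<le> p - 1"
        then have "p \<le> card F" by simp
        \<comment> \<open>The property speaks of exactly \<open>p\<close> edges, so \<open>F\<close>
          is cut down to that size; this does not raise any degree.\<close>
        then obtain F' where F': "F' \<subseteq> F" "card F' = p" "finite F'"
          by (rule obtain_subset_with_card_n)
        have "finite F" using F(1) fE finite_subset by fastforce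
        then have "deg F' v \<le> deg F v" for v
          unfolding deg_def using F'(1) by (intro card_mono) auto
        then have "deg F' v < Suc D" for v using F(2)[of v] le_trans less_Suc_eq_le by blast
        then show False
          using pq_property_no_bounded_deg[OF pq, of F'] F' F(1) p by auto
      qed
    qed
    also have "\<dots> \<le> n - t"
    proof -
      have "t \<le> t * D" using D by simp
      then have tp: "t \<le> p - 1" using p by linarith
      obtain m where m: "p = Suc m" using p by blast
      \<comment> \<open>With \<open>p = m + 1\<close> the comparison is between
        \<open>2 * m^2 + 2 * m\<close> and \<open>2 * (m + 1)^2\<close>, which is where the size of
        \<open>n\<close> enters.\<close>
      have "(p - 1) * Suc (2 * p - 2) + t \<le> m * Suc (2 * m) + m" using tp m by simp
      also have "\<dots> \<le> 2 * p ^ 2" unfolding m by (simp add: power2_eq_square algebra_simps)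
      finally show ?thesis using big by linarith
    qed
    finally have cH: "card ?H \<le> n - t" .
    have "t \<le> t * D" using D by simp
    then have "t \<le> p" using p by linarith
    also have "p \<le> 2 * p ^ 2" by (simp add: power2_eq_square)
    finally have "t \<le> n" using big by simp
    \<comment> \<open>Having fewer than \<open>t\<close> high vertices leaves slack
      \<open>n - t\<close>, enough to absorb all edges of \<open>?H\<close>.\<close>
    then have "(n choose 2) - ((n - card ?S) choose 2) + (n - t) \<le> (n choose 2) - ((n - t) choose 2)"
      using False by (intro choose_two_diff_mono) auto
    moreover have "card E \<le> (n choose 2) - ((n - card ?S) choose 2) + card ?H"
      using card_edges_le_card_edges_off[OF sg, of ?S] n by auto
    ultimately show ?thesis using cH by linarith
  qed
qed

section \<open>An extremal graph, for sharpness\<close>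

text \<open>Make \<open>t\<close> vertices full and add any \<open>r\<close> edges off them. Of
  \<open>p > t * D + r\<close> edges, more than \<open>t * D\<close> meet these vertices, so one of
  them lies on more than \<open>D\<close>.\<close>

lemma extremal_graph_exists:
  fixes p t D r n :: nat
  assumes p: "p = Suc (t * D + r)" and t: "t \<le> n" and r: "r \<le> (n - t) choose 2"
  shows "\<exists>(V :: nat set) E. simple_graph V E \<and> card V = n \<and> pq_property p (Suc D) V E
           \<and> card E = (n choose 2) - ((n - t) choose 2) + r"
proof -
  define V T where "V = {..<n}" and "T = {..<t}"
  then have V: "finite V" "card V = n" and T: "finite T" "card T = t" "T \<subseteq> V"
    using t by auto
  let ?A = "{e. e \<subseteq> V \<and> card e = 2}" and ?B = "{e. e \<subseteq> V - T \<and> card e = 2}"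
  have fin: "finite ?A" using V(1) by auto
  have cAB: "card (?A - ?B) = (n choose 2) - ((n - t) choose 2)"
    using card_pairs_meeting[OF V(1) T(3)] V(2) T(2) by simp
  have "card ?B = (n - t) choose 2"
    using n_subsets[of "V - T" 2] V T by (simp add: card_Diff_subset)
  then have "r \<le> card ?B" using r by simp
  then obtain R where R: "R \<subseteq> ?B" "card R = r" "finite R"
    by (rule obtain_subset_with_card_n)
  let ?E = "(?A - ?B) \<union> R"
  have "(?A - ?B) \<inter> R = {}" using R(1) by blast
  with finite_Diff[OF fin] R(3) have "card ?E = card (?A - ?B) + card R"
    by (rule card_Un_disjoint)
  then have cE: "card ?E = (n choose 2) - ((n - t) choose 2) + r"
    unfolding cAB R(2) .
  have "?E \<subseteq> ?A" using R(1) by blast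
  then have sg: "simple_graph V ?E" using V(1) unfolding simple_graph_def by blast
  have "pq_property p (Suc D) V ?E"
    unfolding pq_property_def
  proof (intro allI impI)
    fix F assume "F \<subseteq> ?E \<and> card F = p"
    then have F: "F \<subseteq> ?E" "card F = p" by auto
    have fF: "finite F" by (rule card_ge_0_finite) (use F(2) p in simp)
    have "\<exists>v\<in>T. Suc D \<le> deg F v"
    proof (rule ccontr)
      assume "\<not> ?thesis"
      then have le: "\<And>v. v \<in> T \<Longrightarrow> deg F v \<le> D" by (auto simp: not_less_eq_eq)
      have "F \<subseteq> R \<union> (\<Union>v\<in>T. {e \<in> F. v \<in> e})"
      proof
        fix e assume e: "e \<in> F"
        show "e \<in> R \<union> (\<Union>v\<in>T. {e \<in> F. v \<in> e})"
        proof (cases "e \<in> R")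
          case False
          then have "e \<in> ?A - ?B" using e F(1) by blast
          then have "\<exists>v\<in>T. v \<in> e" by auto
          then show ?thesis using e by blast
        qed simp
      qed
      then have "card F \<le> card (R \<union> (\<Union>v\<in>T. {e \<in> F. v \<in> e}))"
        using fF R(3) T(1) by (intro card_mono) auto
      also have "\<dots> \<le> card R + card (\<Union>v\<in>T. {e \<in> F. v \<in> e})" by (rule card_Un_le)
      also have "\<dots> \<le> card R + (\<Sum>v\<in>T. deg F v)"
        unfolding deg_def by (intro add_left_mono card_UN_le T)
      also have "\<dots> \<le> r + t * D"
        using R(2) le sum_bounded_above[of T "deg F" D] T by simp
      finally show False using F(2) p by simp
    qed
    then obtain v where v: "v \<in> T" "Suc D \<le> card {e \<in> F. v \<in> e}" by (auto simp: deg_def)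
    from v(2) obtain F' where "F' \<subseteq> {e \<in> F. v \<in> e}" "card F' = Suc D"
      by (rule obtain_subset_with_card_n)
    then show "\<exists>F'\<subseteq>F. card F' = Suc D \<and> (\<exists>v\<in>V. \<forall>e\<in>F'. v \<in> e)"
      using v(1) T(3) by (intro exI[of _ F'] conjI bexI[of _ v]) auto
  qed
  then show ?thesis using sg cE by (intro exI[of _ V] exI[of _ ?E] conjI V(2))
qed

theorem theorem1:
  fixes p q t r n :: nat
  assumes "p \<ge> q" and "q \<ge> 3"
    and "t = (p - 1) div (q - 1)"
    and "r = (p - 1) mod (q - 1)"
    and "n \<ge> 2 * p ^ 2"
  shows "(\<forall>(V :: 'a set) E. simple_graph V E \<and> card V = n \<and> pq_property p q V E
             \<longrightarrow> card E \<le> (n choose 2) - ((n - t) choose 2) + r)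
       \<and> (\<exists>(V :: nat set) E. simple_graph V E \<and> card V = n \<and> pq_property p q V E
             \<and> card E = (n choose 2) - ((n - t) choose 2) + r)"
proof -
  \<comment> \<open>\<open>D\<close> is the largest degree that rules out \<open>q\<close> edges at
    a vertex.\<close>
  obtain D where q: "q = Suc D" and D: "D \<ge> 2" using assms(2) by (cases q) auto
  have "t * D + r = p - 1" using assms(3,4) q by simp
  then have p: "p = Suc (t * D + r)" using assms(1,2) by simp
  have r: "r < D" using assms(4) q D by simp
  have "t \<le> t * D" using D by simp
  then have tr: "t + r < p" using p by linarith
  have "2 * p \<le> 2 * p ^ 2" by (simp add: power2_eq_square)
  then have n: "2 * p \<le> n" using assms(5) by linarith
  \<comment> \<open>Room for the \<open>r\<close> extra edges: \<open>r + 2\<close> vertices already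
    span at least \<open>r\<close> pairs.\<close>
  have "Suc (Suc r) \<le> n - t" using tr n by linarith
  then have "Suc (Suc r) choose 2 \<le> (n - t) choose 2" by (rule binomial_right_mono)
  then have "r \<le> (n - t) choose 2" by (simp add: numeral_2_eq_2)
  moreover have "t \<le> n" using tr n by linarith
  ultimately have "\<exists>(V :: nat set) E. simple_graph V E \<and> card V = n \<and> pq_property p q V E
      \<and> card E = (n choose 2) - ((n - t) choose 2) + r"
    unfolding q by (intro extremal_graph_exists[OF p])
  moreover have "card E \<le> (n choose 2) - ((n - t) choose 2) + r"
    if "simple_graph V E \<and> card V = n \<and> pq_property p q V E" for V :: "'a set" and E
    using that card_edges_upper_bound[OF _ _ _ p r D assms(5)] unfolding q by (elim conjE)
  ultimately show ?thesis by (intro conjI allI impI)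
qed

end
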